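(* Let $\mathcal P'$ be the set of packing paths and $\mathcal K$ the set of skew Dyck paths whose down-steps come in two colors $d,d'$. Define $f:\mathcal P'\to\mathcal K$ recursively by $f(\varepsilon)=\varepsilon$ and, for $P\ne\varepsilon$, $$f(P)=\begin{cases} u\,d\,f(Q) & \text{if } P=UFD\,Q \text{ with } Q\in\mathcal P',\\ u\,d'\,f(Q) & \text{if } P=U\overline U\,\overline D D\,Q\text{ with } Q\in\mathcal P',\\ u\,f(UQ)\,\ell & \text{if } P=UF\overline F\,Q \text{ with } UQ\in\mathcal P',\\ u\,f(Q)\,d\,f(R) & \text{if } P=U\overline U\,Q\,\overline D D\,R\text{ with } Q,R\in\mathcal P',\ Q\neq\varepsilon,\\ u\,f(UR)\,d'\,f(Q) & \text{if } P=U\overline U\,Q\,\overline D\,\overline F\,R\text{ with } Q\in\mathcal P',\ UR\in\mathcal P'. \end{cases}$$ Then $f$ is a bijection from $\mathcal P'$ onto $\mathcal K$.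
   Context: Consider the hexagonal packing of the plane by circles of radius $2$ with centers $(2+4i+2j,\,2\sqrt3\,j)$, $i,j\in\mathbb Z$; the origin is the tangency point of two horizontally adjacent circles. The tangency points cut every circle into six arcs. Traversed from left to right these give six types of steps (angles measured on the circle carrying the arc): $U$ from $180^\circ$ to $120^\circ$ (displacement $(1,\sqrt3)$), $F$ from $120^\circ$ to $60^\circ$ (displacement $(2,0)$), $D$ from $60^\circ$ to $0^\circ$ (displacement $(1,-\sqrt3)$), $\overline U$ from $300^\circ$ to $360^\circ$ (displacement $(1,\sqrt3)$), $\overline F$ from $240^\circ$ to $300^\circ$ (displacement $(2,0)$), $\overline D$ from $180^\circ$ to $240^\circ$ (displacement $(1,-\sqrt3)$). A path in the packing starts at the origin, is a concatenation of such arcs of circles of the packing, each starting where the previous one ends, and stays in the quarter plane $x,y\ge 0$. Equivalently, it is a word in $\{U,F,D,\overline U,\overline F,\overline D\}$ whose first step (if any) is $U$, in which $U$ or $\overline F$ can only be followed by $F$ or $\overline U$; $F$ or $\overline D$ only by $\overline F$ or $D$; $\overline U$ or $D$ only by $U$ or $\overline D$; and which never goes below ordinate $0$. A packing path is such a path ending on the $x$-axis; $\mathcal P'$ is the set of all packing paths, identified with words, including the empty path $\varepsilon$. A skew Dyck path is a lattice path in the quarter plane starting at the origin, ending on the $x$-axis, consisting of steps $u=(1,1)$, $d=(1,-1)$, $\ell=(-1,-1)$, and in which up-steps and left-steps do not overlap (i.e. neither $u\ell$ nor $\ell u$ occurs as two consecutive steps). $\mathcal K$ is the set of skew Dyck paths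 in which each down-step is given one of two colors, written $d$ and $d'$ (the empty path $\varepsilon$ included). *)

theory Defs
  imports "HOL-Complex_Analysis.Contour_Integration"
begin

section \<open>Paths in the hexagonal circle packing\<close>

text \<open>The constructors \<open>Ub\<close>, \<open>Fb\<close>, \<open>Db\<close> are the barred steps, which run along lower half-circles.\<close>

datatype step = U | F | D | Ub | Fb | Db

primrec start_angle :: "step \<Rightarrow> real" where
  "start_angle U = pi"
| "start_angle F = 2 * pi / 3"
| "start_angle D = pi / 3"
| "start_angle Ub = 5 * pi / 3"
| "start_angle Fb = 4 * pi / 3"
| "start_angle Db = pi"

primrec end_angle :: "step \<Rightarrow> real" where
  "end_angle U = 2 * pi / 3"
| "end_angle F = pi / 3"
| "end_angle D = 0"
| "end_angle Ub = 2 * pi"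
| "end_angle Fb = 5 * pi / 3"
| "end_angle Db = 4 * pi / 3"

definition centre :: "int \<Rightarrow> int \<Rightarrow> complex" where
  "centre i j = Complex (2 + 4 * of_int i + 2 * of_int j) (2 * sqrt 3 * of_int j)"

definition circle_arc :: "int \<Rightarrow> int \<Rightarrow> step \<Rightarrow> real \<Rightarrow> complex" where
  "circle_arc i j s = part_circlepath (centre i j) 2 (start_angle s) (end_angle s)"

definition quarter_plane :: "complex set" where
  "quarter_plane = {z. 0 \<le> Re z \<and> 0 \<le> Im z}"

text \<open>\<open>packing_walk p w q\<close>: the word \<open>w\<close> is realised by consecutive arcs of circles of the packing
  leading from \<open>p\<close> to \<open>q\<close> inside the quarter plane.\<close>

inductive packing_walk :: "complex \<Rightarrow> step list \<Rightarrow> complex \<Rightarrow> bool" where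
  Nil: "packing_walk p [] p"
| Cons: "pathstart (circle_arc i j s) = p \<Longrightarrow> path_image (circle_arc i j s) \<subseteq> quarter_plane \<Longrightarrow>
    packing_walk (pathfinish (circle_arc i j s)) w q \<Longrightarrow> packing_walk p (s # w) q"

definition packing_paths :: "step list set" where
  "packing_paths = {w. \<exists>q. packing_walk 0 w q \<and> Im q = 0}"


section \<open>Skew Dyck paths with coloured down-steps\<close>

datatype 'c skew_step = Up | Down 'c | Left

primrec skew_vec :: "'c skew_step \<Rightarrow> int \<times> int" where
  "skew_vec Up = (1, 1)"
| "skew_vec (Down c) = (1, - 1)"
| "skew_vec Left = (- 1, - 1)"

definition skew_pos :: "'c skew_step list \<Rightarrow> int \<times> int" where
  "skew_pos w = sum_list (map skew_vec w)"

definition skew_dyck_paths :: "'c skew_step list set" where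
  "skew_dyck_paths = {w.
     (\<forall>n \<le> length w. 0 \<le> fst (skew_pos (take n w)) \<and> 0 \<le> snd (skew_pos (take n w))) \<and>
     snd (skew_pos w) = 0 \<and>
     successively (\<lambda>s t. (s, t) \<noteq> (Up, Left) \<and> (s, t) \<noteq> (Left, Up)) w}"

text \<open>\<open>Down Plain\<close> is $d$ and \<open>Down Primed\<close> is $d'$.\<close>

datatype colour = Plain | Primed

abbreviation two_coloured_skew_dyck_paths :: "colour skew_step list set" where
  "two_coloured_skew_dyck_paths \<equiv> skew_dyck_paths"


section \<open>Packing paths as words\<close>

text \<open>Ordinates are measured in units of $\sqrt 3$.\<close>

primrec dx :: "step \<Rightarrow> int" where
  "dx U = 1" | "dx F = 2" | "dx D = 1" | "dx Ub = 1" | "dx Fb = 2" | "dx Db = 1"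

primrec dy :: "step \<Rightarrow> int" where
  "dy U = 1" | "dy F = 0" | "dy D = - 1" | "dy Ub = 1" | "dy Fb = 0" | "dy Db = - 1"

fun follows :: "step \<Rightarrow> step \<Rightarrow> bool" where
  "follows U t = (t = F \<or> t = Ub)"
| "follows Fb t = (t = F \<or> t = Ub)"
| "follows F t = (t = Fb \<or> t = D)"
| "follows Db t = (t = Fb \<or> t = D)"
| "follows Ub t = (t = U \<or> t = Db)"
| "follows D t = (t = U \<or> t = Db)"

text \<open>Starting at ordinate \<open>h\<close>, the word never goes below ordinate \<open>0\<close> and ends there.\<close>

primrec excursion :: "int \<Rightarrow> step list \<Rightarrow> bool" where
  "excursion h [] \<longleftrightarrow> h = 0"
| "excursion h (s # w) \<longleftrightarrow> 0 \<le> h + dy s \<and> excursion (h + dy s) w"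

definition vertex :: "int \<Rightarrow> int \<Rightarrow> complex" where
  "vertex X Y = Complex (of_int X) (sqrt 3 * of_int Y)"

text \<open>The residues of a tangency point determine which of the six arcs start there.\<close>

fun enabled :: "int \<Rightarrow> int \<Rightarrow> step \<Rightarrow> bool" where
  "enabled X Y U \<longleftrightarrow> even Y \<and> 4 dvd (X - Y)"
| "enabled X Y Db \<longleftrightarrow> even Y \<and> 4 dvd (X - Y)"
| "enabled X Y F \<longleftrightarrow> odd Y \<and> 4 dvd (X - Y)"
| "enabled X Y Ub \<longleftrightarrow> odd Y \<and> 4 dvd (X - Y)"
| "enabled X Y D \<longleftrightarrow> odd Y \<and> 4 dvd (X - Y - 2)"
| "enabled X Y Fb \<longleftrightarrow> odd Y \<and> 4 dvd (X - Y - 2)"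

lemma enabled_follows:
  "enabled X Y s \<Longrightarrow> enabled (X + dx s) (Y + dy s) t \<longleftrightarrow> follows s t"
  by (cases s; cases t; simp; presburger)

lemma vertex_eq_iff [simp]: "vertex X Y = vertex X' Y' \<longleftrightarrow> X = X' \<and> Y = Y'"
  by (simp add: vertex_def)

text \<open>\<open>(ox s, oy s)\<close> are the coordinates, in the units of \<^const>\<open>vertex\<close>, of the start of the
  arc \<open>s\<close> relative to the centre of its circle.\<close>

primrec ox :: "step \<Rightarrow> int" where
  "ox U = - 2" | "ox F = - 1" | "ox D = 1" | "ox Ub = 1" | "ox Fb = - 1" | "ox Db = - 2"

primrec oy :: "step \<Rightarrow> int" where
  "oy U = 0" | "oy F = 1" | "oy D = 1" | "oy Ub = - 1" | "oy Fb = - 1" | "oy Db = 0"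

lemma cos_sin_240: "cos (4 * pi / 3) = - 1 / 2" "sin (4 * pi / 3) = - (sqrt 3 / 2)"
proof -
  have e: "4 * pi / 3 = pi / 3 + pi" by simp
  show "cos (4 * pi / 3) = - 1 / 2" "sin (4 * pi / 3) = - (sqrt 3 / 2)"
    unfolding e by (simp_all only: cos_periodic_pi sin_periodic_pi cos_60 sin_60)
qed

lemma cos_sin_300: "cos (5 * pi / 3) = 1 / 2" "sin (5 * pi / 3) = - (sqrt 3 / 2)"
proof -
  have e: "5 * pi / 3 = 2 * pi - pi / 3" by simp
  show "cos (5 * pi / 3) = 1 / 2" "sin (5 * pi / 3) = - (sqrt 3 / 2)"
    unfolding e by (simp_all only: cos_2pi_minus sin_2pi_minus cos_60 sin_60)
qed

lemma cos_sin_120: "cos (2 * pi / 3) = - 1 / 2" "sin (2 * pi / 3) = sqrt 3 / 2"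
  using cos_120' sin_120' by (simp_all add: mult.commute)

lemmas angle_values = cos_sin_120 cos_sin_240 cos_sin_300 cos_60 sin_60

lemma pathstart_pathfinish_circle_arc:
  "pathstart (circle_arc i j s) = centre i j + 2 * cis (start_angle s)"
  "pathfinish (circle_arc i j s) = centre i j + 2 * cis (end_angle s)"
  by (simp_all add: circle_arc_def cis_conv_exp)

lemma pathstart_circle_arc:
  "pathstart (circle_arc i j s) = vertex (2 + 4 * i + 2 * j + ox s) (2 * j + oy s)"
  by (cases s)
    (simp_all add: pathstart_pathfinish_circle_arc centre_def vertex_def complex_eq_iff angle_values,
      simp_all add: algebra_simps)

lemma pathfinish_circle_arc:
  "pathfinish (circle_arc i j s) = vertex (2 + 4 * i + 2 * j + ox s + dx s) (2 * j + oy s + dy s)"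
  by (cases s)
    (simp_all add: pathstart_pathfinish_circle_arc centre_def vertex_def complex_eq_iff angle_values,
      simp_all add: algebra_simps)

lemma exists_arc_iff_enabled:
  "(\<exists>i j. X = 2 + 4 * i + 2 * j + ox s \<and> Y = 2 * j + oy s) \<longleftrightarrow> enabled X Y s"
    (is "?l \<longleftrightarrow> _")
proof -
  have "?l \<longleftrightarrow> even (Y - oy s) \<and> 4 dvd (X - ox s - 2 - (Y - oy s))"
  proof
    assume ?l
    then obtain i j where *: "X = 2 + 4 * i + 2 * j + ox s" "Y = 2 * j + oy s" by blast
    then have "Y - oy s = 2 * j" "X - ox s - 2 - (Y - oy s) = 4 * i" by simp_all
    then show "even (Y - oy s) \<and> 4 dvd (X - ox s - 2 - (Y - oy s))" by simp
  next
    assume "even (Y - oy s) \<and> 4 dvd (X - ox s - 2 - (Y - oy s))"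
    then obtain i j where *: "Y - oy s = 2 * j" "X - ox s - 2 - (Y - oy s) = 4 * i"
      by (meson dvdE)
    then have "X = 2 + 4 * i + 2 * j + ox s \<and> Y = 2 * j + oy s" by linarith
    then show ?l by blast
  qed
  also have "\<dots> \<longleftrightarrow> enabled X Y s"
    by (cases s; simp; presburger)
  finally show ?thesis .
qed

lemma cos_sin_start_angle:
  "2 * cos (start_angle s) = of_int (ox s)" "2 * sin (start_angle s) = sqrt 3 * of_int (oy s)"
  by (cases s; simp add: angle_values)+

lemma cos_ge_on_arc:
  assumes "t \<in> closed_segment (start_angle s) (end_angle s)"
  shows "cos t \<ge> cos (start_angle s)"
proof (cases s)
  case U
  then show ?thesis by simp
next
  case Db
  then show ?thesis by simp
next
  case F
  with assms have "t \<le> 2 * pi / 3" "0 \<le> t"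
    using pi_gt_zero by (auto simp: closed_segment_eq_real_ivl split: if_splits)
  with F show ?thesis by (auto intro!: cos_monotone_0_pi_le)
next
  case D
  with assms have "t \<le> pi / 3" "0 \<le> t"
    using pi_gt_zero by (auto simp: closed_segment_eq_real_ivl split: if_splits)
  with D show ?thesis by (auto intro!: cos_monotone_0_pi_le)
next
  case Ub
  with assms have t: "5 * pi / 3 \<le> t" "t \<le> 2 * pi"
    using pi_gt_zero by (auto simp: closed_segment_eq_real_ivl split: if_splits)
  have "cos (2 * pi - 5 * pi / 3) \<le> cos (2 * pi - t)"
    using t by (intro cos_monotone_0_pi_le) auto
  with Ub show ?thesis by (simp only: cos_2pi_minus start_angle.simps)
next
  case Fb
  with assms have t: "4 * pi / 3 \<le> t" "t \<le> 5 * pi / 3"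
    using pi_gt_zero by (auto simp: closed_segment_eq_real_ivl split: if_splits)
  have "cos (2 * pi - 4 * pi / 3) \<le> cos (2 * pi - t)"
    using t by (intro cos_monotone_0_pi_le) auto
  with Fb show ?thesis by (simp only: cos_2pi_minus start_angle.simps)
qed

lemma sin_ge_on_arc:
  assumes t: "t \<in> closed_segment (start_angle s) (end_angle s)"
  shows "s \<in> {U, F, D} \<Longrightarrow> sin t \<ge> 0"
    and "s = Db \<Longrightarrow> sin t \<ge> - (sqrt 3 / 2)"
proof -
  assume "s \<in> {U, F, D}"
  then have "0 \<le> start_angle s" "start_angle s \<le> pi" "0 \<le> end_angle s" "end_angle s \<le> pi"
    using pi_gt_zero by auto
  with t have "0 \<le> t" "t \<le> pi"
    by (auto simp: closed_segment_eq_real_ivl split: if_splits)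
  then show "sin t \<ge> 0" by (rule sin_ge_zero)
next
  assume "s = Db"
  with t have *: "pi \<le> t" "t \<le> 4 * pi / 3"
    using pi_gt_zero by (auto simp: closed_segment_eq_real_ivl split: if_splits)
  have "sin (t - pi) \<le> sin (pi / 3)"
    using * pi_gt_zero by (intro sin_monotone_2pi_le) auto
  then show "sin t \<ge> - (sqrt 3 / 2)" by (simp add: sin_60)
qed

lemma arc_subset_quarter_plane_iff:
  fixes i j :: int and s :: step
  defines "X \<equiv> 2 + 4 * i + 2 * j + ox s" and "Y \<equiv> 2 * j + oy s"
  shows "path_image (circle_arc i j s) \<subseteq> quarter_plane \<longleftrightarrow> 0 \<le> X \<and> 0 \<le> Y \<and> 0 \<le> Y + dy s"
proof
  assume *: "path_image (circle_arc i j s) \<subseteq> quarter_plane"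
  have "pathstart (circle_arc i j s) \<in> quarter_plane" "pathfinish (circle_arc i j s) \<in> quarter_plane"
    using * by blast+
  then show "0 \<le> X \<and> 0 \<le> Y \<and> 0 \<le> Y + dy s"
    unfolding pathstart_circle_arc pathfinish_circle_arc X_def Y_def
    by (auto simp: quarter_plane_def vertex_def zero_le_mult_iff simp del: of_int_add of_int_mult of_int_diff)
next
  assume *: "0 \<le> X \<and> 0 \<le> Y \<and> 0 \<le> Y + dy s"
  show "path_image (circle_arc i j s) \<subseteq> quarter_plane"
  proof
    fix z assume "z \<in> path_image (circle_arc i j s)"
    then obtain t where t: "t \<in> closed_segment (start_angle s) (end_angle s)"
      and z: "z = centre i j + 2 * cis t"
      by (auto simp: circle_arc_def path_image_part_circlepath')
    have "Re z = 2 + 4 * of_int i + 2 * of_int j + 2 * cos t"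
      by (simp add: z centre_def)
    also have "\<dots> \<ge> of_int X"
      using cos_ge_on_arc[OF t] cos_sin_start_angle(1)[of s] by (simp add: X_def)
    finally have re: "0 \<le> Re z" using * by (meson of_int_0_le_iff order_trans)
    have im: "Im z = 2 * sqrt 3 * of_int j + 2 * sin t"
      by (simp add: z centre_def)
    have low: "0 \<le> Im z" if "j \<ge> 1"
    proof -
      have "1 \<le> sqrt 3" by simp
      then have "2 * 1 * 1 \<le> 2 * sqrt 3 * real_of_int j"
        using that by (intro mult_mono) auto
      then show ?thesis using sin_ge_minus_one[of t] im by linarith
    qed
    have upper: "0 \<le> Im z" if "s \<in> {U, F, D}"
    proof -
      have "j \<ge> 0" using that * by (auto simp: Y_def)
      then show ?thesis using sin_ge_on_arc(1)[OF t that] im by simp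
    qed
    have "0 \<le> Im z"
    proof (cases s)
      case Ub then show ?thesis using * low by (auto simp: Y_def)
    next
      case Fb then show ?thesis using * low by (auto simp: Y_def)
    next
      case Db then show ?thesis using * low by (auto simp: Y_def)
    qed (use upper in auto)
    with re show "z \<in> quarter_plane" by (simp add: quarter_plane_def)
  qed
qed

lemma packing_walk_Nil_iff [simp]: "packing_walk p [] q \<longleftrightarrow> p = q"
  by (auto elim: packing_walk.cases intro: packing_walk.intros)

lemma packing_walk_Cons_iff:
  assumes "0 \<le> X" "0 \<le> Y"
  shows "packing_walk (vertex X Y) (s # w) q \<longleftrightarrow>
    enabled X Y s \<and> 0 \<le> Y + dy s \<and> packing_walk (vertex (X + dx s) (Y + dy s)) w q"
    (is "?l \<longleftrightarrow> ?r")
proof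
  assume ?l
  then show ?r
  proof cases
    case (Cons i j)
    from Cons(1) have XY: "X = 2 + 4 * i + 2 * j + ox s" "Y = 2 * j + oy s"
      by (simp_all add: pathstart_circle_arc)
    moreover have "0 \<le> Y + dy s"
      using Cons(2) arc_subset_quarter_plane_iff XY by simp
    ultimately show ?thesis
      using Cons(3) exists_arc_iff_enabled[of X s Y] by (auto simp: pathfinish_circle_arc)
  qed
next
  assume r: ?r
  then obtain i j where XY: "X = 2 + 4 * i + 2 * j + ox s" "Y = 2 * j + oy s"
    using exists_arc_iff_enabled by meson
  show ?l
  proof (rule packing_walk.Cons)
    show "pathstart (circle_arc i j s) = vertex X Y"
      by (simp add: XY pathstart_circle_arc)
    show "path_image (circle_arc i j s) \<subseteq> quarter_plane"
      using arc_subset_quarter_plane_iff r assms XY by simp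
    show "packing_walk (pathfinish (circle_arc i j s)) w q"
      using r by (simp add: XY pathfinish_circle_arc)
  qed
qed

lemma dx_pos: "0 \<le> dx s"
  by (cases s) auto

lemma packing_walk_iff_word:
  assumes "0 \<le> X" "0 \<le> Y"
  shows "(\<exists>q. packing_walk (vertex X Y) w q \<and> Im q = 0) \<longleftrightarrow>
    (w \<noteq> [] \<longrightarrow> enabled X Y (hd w)) \<and> successively follows w \<and> excursion Y w"
  using assms
proof (induction w arbitrary: X Y)
  case Nil
  then show ?case by (simp add: vertex_def)
next
  case (Cons s w)
  have "(\<exists>q. packing_walk (vertex X Y) (s # w) q \<and> Im q = 0) \<longleftrightarrow>
      enabled X Y s \<and> 0 \<le> Y + dy s \<and>
      (\<exists>q. packing_walk (vertex (X + dx s) (Y + dy s)) w q \<and> Im q = 0)"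
    by (simp add: packing_walk_Cons_iff[OF Cons.prems])
  also have "\<dots> \<longleftrightarrow> enabled X Y s \<and> 0 \<le> Y + dy s \<and>
      (w \<noteq> [] \<longrightarrow> enabled (X + dx s) (Y + dy s) (hd w)) \<and> successively follows w \<and>
      excursion (Y + dy s) w"
    using Cons.IH[of "X + dx s" "Y + dy s"] Cons.prems dx_pos[of s]
    by (intro conj_cong refl) simp
  also have "\<dots> \<longleftrightarrow> (s # w \<noteq> [] \<longrightarrow> enabled X Y (hd (s # w))) \<and>
      successively follows (s # w) \<and> excursion Y (s # w)"
    by (cases "enabled X Y s"; cases "w = []") (simp_all add: successively_Cons enabled_follows conj_ac)
  finally show ?case .
qed

theorem packing_paths_iff_word:
  "w \<in> packing_paths \<longleftrightarrow> (w \<noteq> [] \<longrightarrow> hd w = U) \<and> successively follows w \<and> excursion 0 w"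
proof -
  have "vertex 0 0 = 0" by (simp add: vertex_def complex_eq_iff)
  then have "w \<in> packing_paths \<longleftrightarrow>
      (w \<noteq> [] \<longrightarrow> enabled 0 0 (hd w)) \<and> successively follows w \<and> excursion 0 w"
    using packing_walk_iff_word[of 0 0 w] by (simp add: packing_paths_def)
  also have "\<dots> \<longleftrightarrow> (w \<noteq> [] \<longrightarrow> hd w = U) \<and> successively follows w \<and> excursion 0 w"
  proof (cases w)
    case (Cons s v)
    then show ?thesis by (cases s) auto
  qed simp
  finally show ?thesis .
qed


section \<open>First-return decomposition of packing paths\<close>

lemma excursion_append:
  "excursion h v \<Longrightarrow> excursion c w \<Longrightarrow> 0 \<le> c \<Longrightarrow> excursion (h + c) (v @ w)"
proof (induction v arbitrary: h)
  case (Cons s v)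
  then show ?case using Cons.IH[of "h + dy s"] by (simp add: algebra_simps)
qed simp

lemma excursion_first_passage:
  assumes "excursion h w" "1 \<le> c" "c \<le> h"
  shows "\<exists>v s r. w = v @ s # r \<and> excursion (h - c) v \<and> dy s = - 1 \<and> excursion (c - 1) r"
  using assms
proof (induction w arbitrary: h)
  case (Cons s w)
  show ?case
  proof (cases "c \<le> h + dy s")
    case True
    then obtain v s' r where *: "w = v @ s' # r" "excursion (h + dy s - c) v" "dy s' = - 1"
      "excursion (c - 1) r"
      using Cons.IH[of "h + dy s"] Cons.prems by auto
    have "s # w = (s # v) @ s' # r" "excursion (h - c) (s # v)"
      using * True by (simp_all add: algebra_simps)
    with * show ?thesis by blast
  next
    case False
    then have "dy s = - 1" "h = c"
      using Cons.prems by (cases s; simp)+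
    with Cons.prems have "s # w = [] @ s # w" "excursion (h - c) []" "excursion (c - 1) w"
      by simp_all
    with \<open>dy s = - 1\<close> show ?thesis by blast
  qed
qed simp

lemma excursion_first_passage_unique:
  assumes "excursion h v" "excursion h v'" "v @ s # r = v' @ s' # r'" "dy s = - 1" "dy s' = - 1"
  shows "v = v'"
  using assms
proof (induction v arbitrary: h v')
  case Nil
  then show ?case by (cases v') auto
next
  case (Cons a v)
  obtain v'' where v': "v' = a # v''"
    using Cons.prems by (cases v') auto
  have "v = v''"
    using Cons.prems by (intro Cons.IH[of "h + dy a"]) (simp_all add: v')
  with v' show ?case by simp
qed

lemma last_step_of_excursion:
  assumes "successively follows (s # w)" "excursion h w" "even h \<longleftrightarrow> s = Ub \<or> s = D"
  shows "last (s # w) = Ub \<or> last (s # w) = D"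
  using assms
proof (induction w arbitrary: s h)
  case (Cons t w)
  have "even (h + dy t) \<longleftrightarrow> t = Ub \<or> t = D"
    using Cons.prems by (cases s; cases t) auto
  then show ?case
    using Cons.IH[of t "h + dy t"] Cons.prems by simp
qed simp

lemma last_packing_path:
  assumes "w \<in> packing_paths" "w \<noteq> []"
  shows "last w = Ub \<or> last w = D"
proof -
  have *: "hd w = U" "successively follows w" "excursion 0 w"
    using assms by (auto simp: packing_paths_iff_word)
  then have "successively follows (D # w)"
    using assms(2) by (simp add: successively_Cons)
  from last_step_of_excursion[OF this *(3)] show ?thesis
    using assms(2) by simp
qed

lemma packing_path_compose:
  shows "[] \<in> packing_paths"
    and "Q \<in> packing_paths \<Longrightarrow> U # F # D # Q \<in> packing_paths"
    and "Q \<in> packing_paths \<Longrightarrow> U # Ub # Db # D # Q \<in> packing_paths"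
    and "U # Q \<in> packing_paths \<Longrightarrow> U # F # Fb # Q \<in> packing_paths"
  by (auto simp: packing_paths_iff_word successively_Cons)

lemma packing_path_compose':
  assumes Q: "Q \<in> packing_paths" and c: "c = D \<and> S \<in> packing_paths \<or> c = Fb \<and> U # S \<in> packing_paths"
  shows "U # Ub # Q @ Db # c # S \<in> packing_paths"
proof -
  have q: "Q \<noteq> [] \<longrightarrow> hd Q = U" "successively follows Q" "excursion 0 Q"
    using Q by (simp_all add: packing_paths_iff_word)
  have "successively follows (Db # c # S)" "excursion 2 (Db # c # S)"
    using c by (auto simp: packing_paths_iff_word successively_Cons)
  moreover from this(2) have "excursion 2 (Q @ Db # c # S)"
    using excursion_append[OF q(3), of 2 "Db # c # S"] by simp
  moreover have "Q \<noteq> [] \<longrightarrow> follows (last Q) Db"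
    using last_packing_path[OF Q] by auto
  ultimately show ?thesis
    using q(1,2) unfolding packing_paths_iff_word
    by (cases "Q = []") (simp_all add: successively_Cons successively_append_iff)
qed

lemma packing_path_cases:
  assumes P: "P \<in> packing_paths"
  obtains "P = []"
  | Q where "Q \<in> packing_paths" "P = U # F # D # Q"
  | Q where "Q \<in> packing_paths" "P = U # Ub # Db # D # Q"
  | Q where "U # Q \<in> packing_paths" "P = U # F # Fb # Q"
  | Q R where "Q \<in> packing_paths" "R \<in> packing_paths" "Q \<noteq> []" "P = U # Ub # Q @ Db # D # R"
  | Q R where "Q \<in> packing_paths" "U # R \<in> packing_paths" "P = U # Ub # Q @ Db # Fb # R"
proof (cases P)
  case (Cons a P1)
  with P have a: "a = U" and f1: "successively follows (U # P1)" and e1: "excursion 1 P1"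
    by (auto simp: packing_paths_iff_word)
  from e1 obtain b P2 where P1: "P1 = b # P2" by (cases P1) auto
  from f1 P1 consider "b = F" | "b = Ub" by auto
  then show thesis
  proof cases
    case 1
    with e1 P1 have e2: "excursion 1 P2" by simp
    then obtain c Q where P2: "P2 = c # Q" by (cases P2) auto
    with f1 P1 1 consider "c = D" | "c = Fb" by auto
    then show thesis
    proof cases
      case 1
      have "Q \<noteq> [] \<longrightarrow> hd Q = U"
        using f1 e2 unfolding P1 P2 \<open>b = F\<close> 1 by (cases Q) auto
      then have "Q \<in> packing_paths"
        using f1 e2 unfolding P1 P2 \<open>b = F\<close> 1
        by (auto simp: packing_paths_iff_word successively_Cons)
      then show thesis using that(2) Cons a P1 P2 \<open>b = F\<close> 1 by blast
    next
      case 2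
      have "U # Q \<in> packing_paths"
        using f1 e2 unfolding P1 P2 \<open>b = F\<close> 2
        by (auto simp: packing_paths_iff_word successively_Cons)
      then show thesis using that(4) Cons a P1 P2 \<open>b = F\<close> 2 by blast
    qed
  next
    case 2
    with e1 P1 have e2: "excursion 2 P2" by simp
    then obtain Q s S where P2: "P2 = Q @ s # S" and Q: "excursion 0 Q" and s: "dy s = - 1"
      and S: "excursion 1 S"
      using excursion_first_passage[OF e2, of 2] by auto
    have f2: "successively follows (Ub # Q @ s # S)"
      using f1 P1 P2 2 by simp
    have "Q \<noteq> [] \<longrightarrow> hd Q = U"
      using f2 Q by (cases Q) auto
    then have QP: "Q \<in> packing_paths"
      using f2 Q by (auto simp: packing_paths_iff_word successively_Cons successively_append_iff)
    have "follows Ub s" if "Q = []"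
      using f2 that by simp
    moreover have "follows (last Q) s" if "Q \<noteq> []"
      using f2 that by (simp add: successively_Cons successively_append_iff)
    ultimately have sDb: "s = Db"
      using last_packing_path[OF QP] s by (cases "Q = []"; cases s) auto
    obtain t R where SR: "S = t # R" using S by (cases S) auto
    have f3: "successively follows (Db # t # R)"
      using f2 unfolding SR sDb by (simp add: successively_Cons successively_append_iff)
    then consider "t = D" | "t = Fb" by auto
    then show thesis
    proof cases
      case 1
      have "R \<noteq> [] \<longrightarrow> hd R = U"
        using f3 S unfolding SR 1 by (cases R) auto
      then have "R \<in> packing_paths"
        using f3 S unfolding SR 1 by (auto simp: packing_paths_iff_word successively_Cons)
      moreover have "P = U # Ub # Q @ Db # D # R"
        by (simp add: Cons a P1 P2 SR sDb \<open>b = Ub\<close> 1)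
      ultimately show thesis
        using that(3)[of R] that(5)[of Q R] QP by (cases "Q = []") simp_all
    next
      case 2
      have "U # R \<in> packing_paths"
        using f3 S unfolding SR 2 by (auto simp: packing_paths_iff_word successively_Cons)
      then show thesis
        using that(6) QP Cons a P1 P2 SR sDb \<open>b = Ub\<close> 2 by blast
    qed
  qed
qed (rule that(1))

lemma packing_path_append_Db_eq_iff:
  assumes "Q \<in> packing_paths" "Q' \<in> packing_paths"
  shows "Q @ Db # S = Q' @ Db # S' \<longleftrightarrow> Q = Q' \<and> S = S'"
    and "Db # S = Q @ Db # S' \<longleftrightarrow> Q = [] \<and> S = S'"
    and "Q @ Db # S' = Db # S \<longleftrightarrow> Q = [] \<and> S = S'"
proof -
  show "Q @ Db # S = Q' @ Db # S' \<longleftrightarrow> Q = Q' \<and> S = S'"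
    using assms excursion_first_passage_unique[of 0 Q Q' Db S Db S']
    by (auto simp: packing_paths_iff_word)
  show "Db # S = Q @ Db # S' \<longleftrightarrow> Q = [] \<and> S = S'" "Q @ Db # S' = Db # S \<longleftrightarrow> Q = [] \<and> S = S'"
    using assms(1) by (cases Q; auto simp: packing_paths_iff_word)+
qed


section \<open>The map $f$\<close>

text \<open>The last equation only makes the function total.\<close>

function skew_of_packing :: "step list \<Rightarrow> colour skew_step list" where
  "skew_of_packing [] = []"
| "Q \<in> packing_paths \<Longrightarrow>
     skew_of_packing (U # F # D # Q) = Up # Down Plain # skew_of_packing Q"
| "Q \<in> packing_paths \<Longrightarrow>
     skew_of_packing (U # Ub # Db # D # Q) = Up # Down Primed # skew_of_packing Q"
| "U # Q \<in> packing_paths \<Longrightarrow>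
     skew_of_packing (U # F # Fb # Q) = Up # skew_of_packing (U # Q) @ [Left]"
| "Q \<in> packing_paths \<Longrightarrow> R \<in> packing_paths \<Longrightarrow> Q \<noteq> [] \<Longrightarrow>
     skew_of_packing (U # Ub # Q @ Db # D # R) =
       Up # skew_of_packing Q @ Down Plain # skew_of_packing R"
| "Q \<in> packing_paths \<Longrightarrow> U # R \<in> packing_paths \<Longrightarrow>
     skew_of_packing (U # Ub # Q @ Db # Fb # R) =
       Up # skew_of_packing (U # R) @ Down Primed # skew_of_packing Q"
| "P \<notin> packing_paths \<Longrightarrow> skew_of_packing P = undefined"
proof goal_cases
  case (1 P x)
  show ?case
  proof (cases "x \<in> packing_paths")
    case True
    then show ?thesis by (rule packing_path_cases) (metis 1)+
  next
    case False
    then show ?thesis using 1(7) by metis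
  qed
qed (auto simp: packing_path_append_Db_eq_iff packing_path_compose packing_path_compose')

termination
  by (relation "Wellfounded.measure length") auto

end

(* Both families have the same first-return structure.  A nonempty skew Dyck path is uniquely
   u K1 z K2, where z is its first step back to height 0, and the only constraint is that z = l
   forces K1 to be nonempty and K2 to be empty.  The recursive cases for f amount to a bijective
   gluing (A, z, B) |-> P of packing paths, under the same constraint, with
   f(P) = u f(A) z f(B); hence f is a bijection by induction on the length. *)

theory Submission
  imports Defs
begin

section \<open>Skew Dyck paths described by their heights\<close>

primrec rise :: "'c skew_step \<Rightarrow> int" where
  "rise Up = 1" | "rise (Down c) = - 1" | "rise Left = - 1"

primrec skew_excursion :: "int \<Rightarrow> 'c skew_step list \<Rightarrow> bool" where
  "skew_excursion h [] \<longleftrightarrow> h = 0"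
| "skew_excursion h (s # w) \<longleftrightarrow> 0 \<le> h + rise s \<and> skew_excursion (h + rise s) w"

abbreviation no_overlap :: "'c skew_step \<Rightarrow> 'c skew_step \<Rightarrow> bool" where
  "no_overlap s t \<equiv> (s, t) \<noteq> (Up, Left) \<and> (s, t) \<noteq> (Left, Up)"

lemma skew_pos_Nil [simp]: "skew_pos [] = 0"
  by (simp add: skew_pos_def)

lemma skew_pos_Cons [simp]: "skew_pos (s # w) = skew_vec s + skew_pos w"
  by (simp add: skew_pos_def)

lemma snd_skew_vec [simp]: "snd (skew_vec s) = rise s"
  by (cases s) simp_all

text \<open>Each of the three step vectors has ordinate at most its abscissa. Hence x is nonnegative
  wherever y is, and heights alone decide membership in the quarter plane.\<close>

lemma snd_skew_pos_le_fst: "snd (skew_pos w) \<le> fst (skew_pos w)"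
proof (induction w)
  case (Cons s w)
  then show ?case by (cases s) simp_all
qed simp

lemma skew_excursion_iff:
  assumes "0 \<le> h"
  shows "skew_excursion h w \<longleftrightarrow>
    (\<forall>n \<le> length w. 0 \<le> h + snd (skew_pos (take n w))) \<and> h + snd (skew_pos w) = 0"
  using assms
proof (induction w arbitrary: h)
  case (Cons s w)
  have "(\<forall>n \<le> length (s # w). 0 \<le> h + snd (skew_pos (take n (s # w)))) \<longleftrightarrow>
      (\<forall>n \<le> length w. 0 \<le> h + rise s + snd (skew_pos (take n w)))"
    using Cons.prems by (auto simp: All_less_Suc2 simp flip: less_Suc_eq_le)
  \<comment> \<open>The instance \<open>n = 0\<close> is the height after the first step, which the
    induction hypothesis requires to be nonnegative.\<close>
  moreover have "0 \<le> h + rise s"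
    if "\<forall>n \<le> length w. 0 \<le> h + rise s + snd (skew_pos (take n w))"
    using that[rule_format, of 0] by simp
  ultimately show ?case
    using Cons.IH[of "h + rise s"] by (auto simp: add.assoc)
qed auto

lemma skew_dyck_paths_iff:
  "w \<in> skew_dyck_paths \<longleftrightarrow> skew_excursion 0 w \<and> successively no_overlap w"
proof -
  have "0 \<le> fst (skew_pos v) \<and> 0 \<le> snd (skew_pos v) \<longleftrightarrow> 0 \<le> snd (skew_pos v)"
    for v :: "'a skew_step list"
    using snd_skew_pos_le_fst[of v] by linarith
  then show ?thesis
    by (simp add: skew_dyck_paths_def skew_excursion_iff)
qed

section \<open>First-return decomposition of skew Dyck paths\<close>

lemma skew_excursion_append:
  "skew_excursion h v \<Longrightarrow> skew_excursion c w \<Longrightarrow> 0 \<le> c \<Longrightarrow> skew_excursion (h + c) (v @ w)"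
proof (induction v arbitrary: h)
  case (Cons s v)
  then show ?case using Cons.IH[of "h + rise s"] by (simp add: algebra_simps)
qed simp

text \<open>Heights change by one per step, so the first visit below \<open>c\<close> is a fall from
  exactly \<open>c\<close>; up to there the path stays at or above \<open>c\<close> and can be
  lowered by \<open>c\<close>.\<close>

lemma skew_excursion_first_passage:
  assumes "skew_excursion h w" "1 \<le> c" "c \<le> h"
  shows "\<exists>v s r. w = v @ s # r \<and> skew_excursion (h - c) v \<and> s \<noteq> Up \<and> skew_excursion (c - 1) r"
  using assms
proof (induction w arbitrary: h)
  case (Cons s w)
  show ?case
  proof (cases "c \<le> h + rise s")
    case True
    then obtain v s' r where *: "w = v @ s' # r" "skew_excursion (h + rise s - c) v" "s' \<noteq> Up"
      "skew_excursion (c - 1) r"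
      using Cons.IH[of "h + rise s"] Cons.prems by auto
    have "s # w = (s # v) @ s' # r" "skew_excursion (h - c) (s # v)"
      using * True by (simp_all add: algebra_simps)
    with * show ?thesis by blast
  next
    case False
    then have "s \<noteq> Up" "h = c" "rise s = - 1"
      using Cons.prems by (cases s; simp)+
    with Cons.prems have "s # w = [] @ s # w" "skew_excursion (h - c) []" "skew_excursion (c - 1) w"
      by simp_all
    with \<open>s \<noteq> Up\<close> show ?thesis by blast
  qed
qed simp

lemma rise_neq_Up: "s \<noteq> Up \<Longrightarrow> rise s = - 1"
  by (cases s) simp_all

text \<open>If \<open>v\<close> were a proper prefix of \<open>v'\<close>, then \<open>v'\<close>
  would contain the falling step \<open>s\<close> taken at height 0; the other case is
  symmetric.\<close>

lemma skew_excursion_first_passage_unique: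
  assumes "skew_excursion h v" "skew_excursion h v'" "v @ s # r = v' @ s' # r'" "s \<noteq> Up" "s' \<noteq> Up"
  shows "v = v'"
  using assms
proof (induction v arbitrary: h v')
  case Nil
  then show ?case by (cases v') (auto simp: rise_neq_Up)
next
  case (Cons a v)
  obtain v'' where v': "v' = a # v''"
    using Cons.prems by (cases v') (auto simp: rise_neq_Up)
  have "v = v''"
    using Cons.prems by (intro Cons.IH[of "h + rise a"]) (simp_all add: v')
  with v' show ?case by simp
qed

lemma hd_skew_excursion: "skew_excursion 0 w \<Longrightarrow> w \<noteq> [] \<Longrightarrow> hd w = Up"
  by (cases w; cases "hd w") simp_all

lemma last_skew_excursion: "skew_excursion h w \<Longrightarrow> 0 \<le> h \<Longrightarrow> w \<noteq> [] \<Longrightarrow> last w \<noteq> Up"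
  by (induction w arbitrary: h) auto

text \<open>Only emptiness of the two lists matters, so the types are left open and the same
  condition serves skew paths and packing paths.\<close>

definition valid_return :: "'a list \<Rightarrow> 'c skew_step \<Rightarrow> 'b list \<Rightarrow> bool" where
  "valid_return A z B \<longleftrightarrow> z \<noteq> Up \<and> (z = Left \<longrightarrow> A \<noteq> [] \<and> B = [])"

text \<open>A nonempty excursion from height 0 begins with \<open>Up\<close> and does not end with
  it. So an overlap at a junction needs \<open>z = Left\<close> with \<open>K\<close> empty or
  \<open>L\<close> nonempty.\<close>

lemma skew_dyck_path_compose:
  assumes "K \<in> skew_dyck_paths" "L \<in> skew_dyck_paths" "valid_return K z L"
  shows "Up # K @ z # L \<in> skew_dyck_paths"
proof -
  have K: "skew_excursion 0 K" "successively no_overlap K"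
    and L: "skew_excursion 0 L" "successively no_overlap L"
    using assms by (simp_all add: skew_dyck_paths_iff)
  have z: "z \<noteq> Up" "z = Left \<Longrightarrow> K \<noteq> []" "z = Left \<Longrightarrow> L = []"
    using assms(3) by (auto simp: valid_return_def)
  have "skew_excursion 1 (z # L)"
    using L(1) z(1) by (simp add: rise_neq_Up)
  then have "skew_excursion 0 (Up # K @ z # L)"
    using skew_excursion_append[OF K(1), of 1 "z # L"] by simp
  moreover have "successively no_overlap (Up # K @ z # L)"
    using K(2) L(2) z hd_skew_excursion[OF K(1)] hd_skew_excursion[OF L(1)]
      last_skew_excursion[OF K(1)]
    by (cases "K = []"; cases "L = []") (auto simp: successively_Cons successively_append_iff)
  ultimately show ?thesis by (simp add: skew_dyck_paths_iff)
qed

lemma skew_dyck_path_decompose: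
  assumes "w \<in> skew_dyck_paths" "w \<noteq> []"
  obtains K z L where "K \<in> skew_dyck_paths" "L \<in> skew_dyck_paths" "valid_return K z L"
    "w = Up # K @ z # L"
proof -
  have w: "skew_excursion 0 w" "successively no_overlap w"
    using assms(1) by (simp_all add: skew_dyck_paths_iff)
  then obtain w' where w': "w = Up # w'" "skew_excursion 1 w'"
    using hd_skew_excursion[OF w(1) assms(2)] assms(2) by (cases w) auto
  then obtain K z L where *: "w' = K @ z # L" "skew_excursion 0 K" "z \<noteq> Up" "skew_excursion 0 L"
    using skew_excursion_first_passage[of 1 w' 1] by auto
  have o: "successively no_overlap (Up # K @ z # L)"
    using w(2) by (simp add: w' *(1))
  then have "successively no_overlap K" "successively no_overlap (z # L)"
    by (auto simp: successively_Cons successively_append_iff)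
  moreover have "valid_return K z L"
    using o *(3) hd_skew_excursion[OF *(4)]
    by (cases "K = []"; cases "L = []")
      (auto simp: valid_return_def successively_Cons successively_append_iff)
  ultimately show thesis
    using that[of K L z] * w' by (cases "L = []") (simp_all add: skew_dyck_paths_iff successively_Cons)
qed

section \<open>Gluing packing paths along the same decomposition\<close>

text \<open>The gluing of \<open>A\<close> and \<open>B\<close> that corresponds to the skew path \<open>u K z L\<close>, where \<open>K\<close> and \<open>L\<close> are
  the images of \<open>A\<close> and \<open>B\<close>.  Nonempty packing paths begin with \<open>U\<close>, so \<^term>\<open>tl A\<close> stands for the
  \<open>R\<close> (or \<open>Q\<close>) with \<open>A = UR\<close>.  The value at \<open>z = Up\<close> is junk.\<close>

fun glue :: "step list \<Rightarrow> colour skew_step \<Rightarrow> step list \<Rightarrow> step list" where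
  "glue A (Down Plain) B = (if A = [] then U # F # D # B else U # Ub # A @ Db # D # B)"
| "glue A (Down Primed) B = (if A = [] then U # Ub # Db # D # B else U # Ub # B @ Db # Fb # tl A)"
| "glue A Left B = U # F # Fb # tl A"
| "glue A Up B = []"

lemma U_Cons_tl_packing_path:
  assumes "A \<in> packing_paths" "A \<noteq> []"
  shows "U # tl A = A"
  using assms by (cases A) (auto simp: packing_paths_iff_word)

text \<open>Validity matters twice: for \<open>z = Left\<close> the list \<open>B\<close> is
  dropped, and \<open>z = Up\<close> gives the empty junk value.\<close>

lemma length_glue:
  assumes "valid_return A z B"
  shows "length A < length (glue A z B)" "length B < length (glue A z B)"
  using assms by (induction A z B rule: glue.induct) (auto simp: valid_return_def)

lemma glue_packing_paths:
  assumes "A \<in> packing_paths" "B \<in> packing_paths" "valid_return A z B"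
  shows "glue A z B \<in> packing_paths"
    and "skew_of_packing (glue A z B) = Up # skew_of_packing A @ z # skew_of_packing B"
proof -
  have "glue A z B \<in> packing_paths \<and>
    skew_of_packing (glue A z B) = Up # skew_of_packing A @ z # skew_of_packing B"
  proof (cases "A = []")
    case True
    then show ?thesis
      using assms by (cases "(A, z, B)" rule: glue.cases)
        (simp_all add: valid_return_def packing_path_compose)
  next
    case False
    then obtain R where R: "A = U # R"
      using U_Cons_tl_packing_path[OF assms(1)] by metis
    show ?thesis
      \<comment> \<open>With \<open>U # R\<close> for \<open>A\<close>, simplification turns
        \<open>(U # R) @ w\<close> into \<open>U # R @ w\<close>, which the general facts no longer
        match; hence the instantiated versions.\<close>
      using assms unfolding R by (cases "(A, z, B)" rule: glue.cases)
        (simp_all add: R valid_return_def packing_path_compose packing_path_compose'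
          packing_path_compose'[of "U # R", simplified] skew_of_packing.simps(5)[of "U # R", simplified])
  qed
  then show "glue A z B \<in> packing_paths"
    "skew_of_packing (glue A z B) = Up # skew_of_packing A @ z # skew_of_packing B" by simp_all
qed

lemma packing_path_unglue:
  assumes "P \<in> packing_paths" "P \<noteq> []"
  obtains A z B where "A \<in> packing_paths" "B \<in> packing_paths" "valid_return A z B" "P = glue A z B"
  using assms(1)
proof (cases rule: packing_path_cases)
  case (2 Q)
  then show thesis
    using that[of "[]" Q "Down Plain"] by (simp add: valid_return_def packing_path_compose(1))
next
  case (3 Q)
  then show thesis
    using that[of "[]" Q "Down Primed"] by (simp add: valid_return_def packing_path_compose(1))
next
  case (4 Q)
  then show thesis
    using that[of "U # Q" "[]" Left] by (simp add: valid_return_def packing_path_compose(1))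
next
  case (5 Q R)
  then show thesis using that[of Q R "Down Plain"] by (simp add: valid_return_def)
next
  case (6 Q R)
  \<comment> \<open>The pieces swap places, since the image of \<open>U # R\<close> precedes that of
    \<open>Q\<close>. As \<open>U # R\<close> is nonempty, \<open>Q\<close> may be empty
    here.\<close>
  then show thesis using that[of "U # R" Q "Down Primed"] by (simp add: valid_return_def)
qed (use assms(2) in simp)

section \<open>Bijectivity by induction on length\<close>

text \<open>The image of a glued path begins with \<open>Up\<close>. Preserving emptiness in both
  directions is what carries \<open>valid_return\<close> across the map.\<close>

lemma skew_of_packing_eq_Nil_iff:
  assumes "P \<in> packing_paths"
  shows "skew_of_packing P = [] \<longleftrightarrow> P = []"
proof (cases "P = []")
  case False
  then obtain A z B where "A \<in> packing_paths" "B \<in> packing_paths" "valid_return A z B" "P = glue A z B"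
    by (rule packing_path_unglue[OF assms])
  with False show ?thesis by (simp add: glue_packing_paths(2))
qed simp

lemma valid_return_skew_of_packing_iff:
  assumes "A \<in> packing_paths" "B \<in> packing_paths"
  shows "valid_return (skew_of_packing A) z (skew_of_packing B) \<longleftrightarrow> valid_return A z B"
  using assms by (simp add: valid_return_def skew_of_packing_eq_Nil_iff)

lemma skew_of_packing_in_skew_dyck_paths:
  "P \<in> packing_paths \<Longrightarrow> skew_of_packing P \<in> skew_dyck_paths"
proof (induction P rule: length_induct)
  case (1 P)
  show ?case
  proof (cases "P = []")
    case True
    then show ?thesis by (simp add: skew_dyck_paths_iff)
  next
    case False
    then obtain A z B where *: "A \<in> packing_paths" "B \<in> packing_paths" "valid_return A z B"
      "P = glue A z B"
      by (rule packing_path_unglue[OF 1(2)])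
    with 1(1) show ?thesis
      by (simp add: glue_packing_paths(2) length_glue skew_dyck_path_compose
          valid_return_skew_of_packing_iff)
  qed
qed

lemma skew_of_packing_inject:
  assumes "P \<in> packing_paths" "P' \<in> packing_paths" "skew_of_packing P = skew_of_packing P'"
  shows "P = P'"
  using assms
proof (induction P arbitrary: P' rule: length_induct)
  case (1 P)
  show ?case
  proof (cases "P = []")
    case True
    then show ?thesis using 1(3,4) skew_of_packing_eq_Nil_iff[of P'] by simp
  next
    case False
    then have "P' \<noteq> []"
      using 1(2-4) skew_of_packing_eq_Nil_iff by metis
    then obtain A' z' B' where
      P': "A' \<in> packing_paths" "B' \<in> packing_paths" "valid_return A' z' B'" "P' = glue A' z' B'"
      by (rule packing_path_unglue[OF 1(3)])
    obtain A z B where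
      P: "A \<in> packing_paths" "B \<in> packing_paths" "valid_return A z B" "P = glue A z B"
      using False by (rule packing_path_unglue[OF 1(2)])
    have eq: "skew_of_packing A @ z # skew_of_packing B = skew_of_packing A' @ z' # skew_of_packing B'"
      using 1(4) P P' by (simp add: glue_packing_paths(2))
    have "skew_excursion 0 (skew_of_packing A)" "skew_excursion 0 (skew_of_packing A')"
      using P(1) P'(1) skew_of_packing_in_skew_dyck_paths by (simp_all add: skew_dyck_paths_iff)
    \<comment> \<open>Both sides of \<open>eq\<close> are cut at their first return to height 0,
      which is unique.\<close>
    then have "skew_of_packing A = skew_of_packing A'"
      using P(3) P'(3) eq
      by (auto simp: valid_return_def elim!: skew_excursion_first_passage_unique)
    with eq have "skew_of_packing A = skew_of_packing A'" "z = z'"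
      "skew_of_packing B = skew_of_packing B'" by simp_all
    moreover have "length A < length P" "length B < length P"
      using P length_glue by simp_all
    ultimately have "A = A'" "B = B'"
      using 1(1) P(1,2) P'(1,2) by blast+
    with \<open>z = z'\<close> show ?thesis by (simp add: P(4) P'(4))
  qed
qed

text \<open>Preimages of the two shorter components, given by induction, are glued to a preimage of
  \<open>w\<close>.\<close>

lemma skew_dyck_path_in_image:
  "w \<in> skew_dyck_paths \<Longrightarrow> w \<in> skew_of_packing ` packing_paths"
proof (induction w rule: length_induct)
  case (1 w)
  show ?case
  proof (cases "w = []")
    case True
    then show ?thesis using packing_path_compose(1) by force
  next
    case False
    then obtain K z L where *: "K \<in> skew_dyck_paths" "L \<in> skew_dyck_paths" "valid_return K z L"
      "w = Up # K @ z # L"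
      by (rule skew_dyck_path_decompose[OF 1(2)])
    moreover from this(4) have "length K < length w" "length L < length w"
      by simp_all
    ultimately obtain A B where AB: "A \<in> packing_paths" "skew_of_packing A = K"
      "B \<in> packing_paths" "skew_of_packing B = L"
      using 1(1) by blast
    with *(3) have "valid_return A z B"
      using valid_return_skew_of_packing_iff by blast
    then show ?thesis
      using glue_packing_paths[of A B z] AB *(4) by (metis image_eqI)
  qed
qed

theorem proposition1:
  shows "bij_betw skew_of_packing packing_paths two_coloured_skew_dyck_paths"
  using skew_of_packing_in_skew_dyck_paths skew_of_packing_inject skew_dyck_path_in_image
  by (auto simp: bij_betw_def inj_on_def)

end
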